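(* Let $$J(t)=2\sum_{d>0\ \mathrm{odd}} e^{dt/2}\,\frac{(5d)!!}{(d!!)^5}.$$ Then $J$ satisfies the inhomogeneous Picard-Fuchs equation $$\Big(\frac{d}{dt}\Big)^4 J-5e^t\Big(5\frac{d}{dt}+1\Big)\Big(5\frac{d}{dt}+2\Big)\Big(5\frac{d}{dt}+3\Big)\Big(5\frac{d}{dt}+4\Big)J=\frac{15}{8}\,e^{t/2}.$$
   Context: Here $n!!=n(n-2)(n-4)\cdots1$ for odd $n>0$, and the identity is one of formal power series in $e^{t/2}$ (where $\frac{d}{dt}e^{dt/2}=\frac d2e^{dt/2}$). *)

theory Defs
  imports "HOL-Computational_Algebra.Formal_Power_Series"
begin

(* Only the values at odd arguments are used below. *)
fun double_fact :: "nat \<Rightarrow> nat" where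
  "double_fact 0 = 1"
| "double_fact (Suc 0) = 1"
| "double_fact (Suc (Suc n)) = Suc (Suc n) * double_fact n"

(* Power series in e^(t/2) are power series whose indeterminate fps_X stands for e^(t/2). *)
abbreviation exp_half :: "'a::field_char_0 fps" where
  "exp_half \<equiv> fps_X"

abbreviation exp_t :: "'a::field_char_0 fps" where
  "exp_t \<equiv> exp_half ^ 2"

(* In terms of q = e^(t/2), the chain rule gives d/dt = (1/2) q d/dq; see ddt_exp_half_power. *)
definition ddt :: "'a::field_char_0 fps \<Rightarrow> 'a fps" where
  "ddt f = fps_const (1 / 2) * fps_XD f"

lemma ddt_exp_half_power:
  "ddt (exp_half ^ d) = fps_const (of_nat d / 2) * exp_half ^ d"
  by (rule fps_ext) (simp add: ddt_def)

(* The first-order operator 5 d/dt + k. *)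
definition five_ddt_plus :: "nat \<Rightarrow> 'a::field_char_0 fps \<Rightarrow> 'a fps" where
  "five_ddt_plus k f = 5 * ddt f + of_nat k * f"

definition J :: "'a::field_char_0 fps" where
  "J = 2 * Abs_fps (\<lambda>d. if odd d
         then of_nat (double_fact (5 * d)) / of_nat (double_fact d) ^ 5 else 0)"

end

theory Submission
  imports Defs
begin

unbundle fps_syntax

text \<open>
  On the coefficient of \<open>e^(d t/2)\<close> the operators act by scalars: \<open>d/dt\<close> by \<open>d/2\<close> and
  \<open>5 d/dt + k\<close> by \<open>(5 d + 2 k)/2\<close>. Passing from \<open>d\<close> to \<open>d + 2\<close> multiplies \<open>(5d)!!\<close> by
  \<open>5 (d + 2) (5 d + 2) (5 d + 4) (5 d + 6) (5 d + 8)\<close> and \<open>(d!!)^5\<close> by \<open>(d + 2)^5\<close>, so both terms of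
  the operator cancel except at \<open>d = 1\<close>, where only \<open>(1/2)^4 * 2 * 5!! = 15/8\<close> remains.
\<close>

lemma fps_nth_numeral_mult:
  "((numeral k :: 'a::comm_ring_1 fps) * f) $ n = numeral k * f $ n"
  by (simp add: numeral_fps_const)

lemma fps_nth_ddt_funpow: "(ddt ^^ k) f $ n = (of_nat n / 2) ^ k * f $ n"
  by (induction k) (simp_all add: ddt_def)

lemma fps_nth_five_ddt_plus:
  "five_ddt_plus k f $ n = (of_nat (5 * n + 2 * k) / 2) * f $ n"
proof -
  \<comment> \<open>Here \<open>5\<close> and \<open>of_nat k\<close> are themselves series;
    rewritten as \<open>fps_const\<close>, they scale each coefficient.\<close>
  have "five_ddt_plus k f = fps_const 5 * (fps_const (1 / 2) * fps_XD f) + fps_const (of_nat k) * f"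
    by (simp only: five_ddt_plus_def ddt_def numeral_fps_const fps_of_nat)
  then have "five_ddt_plus k f $ n = 5 * (1 / 2 * (of_nat n * f $ n)) + of_nat k * f $ n"
    by (simp only: fps_add_nth fps_mult_left_const_nth fps_XD_nth)
  then show ?thesis
    by (simp add: field_simps)
qed

lemma fps_nth_J:
  "(J :: 'a::field_char_0 fps) $ n
     = (if odd n then 2 * of_nat (double_fact (5 * n)) / of_nat (double_fact n) ^ 5 else 0)"
  by (simp add: J_def fps_nth_numeral_mult)

lemma double_fact_pos: "double_fact n > 0"
  by (induction n rule: double_fact.induct) auto

text \<open>Raising \<open>d\<close> by 2 raises \<open>5 * d\<close> by 10, which is five steps of
  the recursion.\<close>

lemma double_fact_add_10:
  "double_fact (n + 10)
     = (n + 10) * (n + 8) * (n + 6) * (n + 4) * (n + 2) * double_fact n"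
proof -
  have step: "double_fact (m + 2) = (m + 2) * double_fact m" for m
    by simp
  show ?thesis
    using step [of n] step [of "n + 2"] step [of "n + 4"] step [of "n + 6"] step [of "n + 8"]
    by (simp only: add.assoc mult.assoc) simp
qed

text \<open>Multiplication by \<open>exp_t\<close> shifts coefficients by two, so this is the
  cancellation of the two terms of the equation at index \<open>n + 2\<close>. For even
  \<open>n\<close> both sides vanish.\<close>

lemma J_recurrence:
  "(of_nat (n + 2) / 2) ^ 4 * (J :: 'a::field_char_0 fps) $ (n + 2)
     = 5 * ((of_nat (5 * n + 2) / 2) * (of_nat (5 * n + 4) / 2) *
            (of_nat (5 * n + 6) / 2) * (of_nat (5 * n + 8) / 2)) * J $ n"
proof (cases "odd n")
  case True
  define D where "D = (of_nat (double_fact n) :: 'a)"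
  define m where "m = (of_nat (n + 2) :: 'a)"
  define A where "A = (of_nat (double_fact (5 * n)) :: 'a)"
  define P where "P = (of_nat ((5 * n + 2) * (5 * n + 4) * (5 * n + 6) * (5 * n + 8)) :: 'a)"
  have nz: "D \<noteq> 0" "m \<noteq> 0"
    using double_fact_pos [of n] of_nat_eq_0_iff [of "n + 2", where 'a = 'a]
    by (auto simp: D_def m_def simp del: of_nat_add)
  have den: "of_nat (double_fact (n + 2)) = m * D"
    by (simp add: D_def m_def distrib_right)
  \<comment> \<open>The top factor \<open>5 * n + 10\<close> supplies one more factor
    \<open>n + 2\<close>; the other four are those produced by the operators
    \<open>five_ddt_plus k\<close>.\<close>
  have "double_fact (5 * (n + 2)) =
      5 * (n + 2) * ((5 * n + 2) * (5 * n + 4) * (5 * n + 6) * (5 * n + 8)) * double_fact (5 * n)"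
  proof -
    have "5 * (n + 2) = 5 * n + 10"
      by simp
    then show ?thesis
      by (simp only: double_fact_add_10 mult_ac)
  qed
  then have num: "of_nat (double_fact (5 * (n + 2))) = 5 * m * P * A"
    by (simp only: of_nat_mult P_def A_def m_def of_nat_numeral)
  have "(m / 2) ^ 4 * J $ (n + 2) = (m / 2) ^ 4 * (2 * (5 * m * P * A) / (m * D) ^ 5)"
    using True by (simp only: fps_nth_J den num) simp
  \<comment> \<open>The factor \<open>m ^ 5\<close> in the denominator cancels against
    \<open>m ^ 4\<close> from the derivatives and the \<open>m\<close> from the numerator;
    \<open>16\<close> is the \<open>2 ^ 4\<close> left over.\<close>
  also have "\<dots> = 5 * (P / 16) * (2 * A / D ^ 5)"
  proof -
    have "m ^ 5 = m ^ 4 * m"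
      by (simp flip: power_Suc2)
    with nz show ?thesis
      by (simp add: power_mult_distrib power_divide)
  qed
  also have "\<dots> = 5 * (P / 16) * J $ n"
    using True by (simp add: fps_nth_J A_def D_def)
  also have "P / 16 = (of_nat (5 * n + 2) / 2) * (of_nat (5 * n + 4) / 2) *
      (of_nat (5 * n + 6) / 2) * (of_nat (5 * n + 8) / 2)"
    by (simp only: P_def of_nat_mult) simp
  finally show ?thesis
    by (simp only: m_def)
qed (simp add: fps_nth_J)

theorem mainTheorem2:
  shows "(ddt ^^ 4) (J :: 'a::field_char_0 fps)
           - 5 * exp_t * (five_ddt_plus 1 \<circ> five_ddt_plus 2 \<circ> five_ddt_plus 3 \<circ> five_ddt_plus 4) J
         = fps_const (15 / 8) * exp_half"
proof (rule fps_ext)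
  fix n :: nat
  define L :: "'a fps"
    where "L = (five_ddt_plus 1 \<circ> five_ddt_plus 2 \<circ> five_ddt_plus 3 \<circ> five_ddt_plus 4) J"
  \<comment> \<open>Below index 2 the summand with \<open>exp_t\<close> contributes nothing, so only
    \<open>J\<close> itself matters there.\<close>
  consider "n = 0" | "n = 1" | d where "n = d + 2"
    by (cases n rule: double_fact.cases) auto
  then have "(ddt ^^ 4) J $ n - 5 * (exp_t * L) $ n = (fps_const (15 / 8) * exp_half) $ n"
  proof cases
    case 2
    have "double_fact 5 = 15"
      by (simp add: numeral_eq_Suc)
    with 2 show ?thesis
      by (simp add: fps_nth_ddt_funpow fps_nth_J fps_X_power_mult_nth power_numeral_reduce)
  next
    case 3
    have "L $ d = (of_nat (5 * d + 2) / 2) * (of_nat (5 * d + 4) / 2) *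
        (of_nat (5 * d + 6) / 2) * (of_nat (5 * d + 8) / 2) * J $ d"
      by (simp add: L_def fps_nth_five_ddt_plus del: of_nat_add of_nat_mult)
    then have "(ddt ^^ 4) J $ n = 5 * L $ d"
      using J_recurrence [of d, where 'a = 'a] 3
      by (simp only: fps_nth_ddt_funpow mult.assoc)
    with 3 show ?thesis
      by (simp add: fps_X_power_mult_nth)
  qed (simp add: fps_nth_ddt_funpow fps_nth_J fps_X_power_mult_nth)
  then show "((ddt ^^ 4) J - 5 * exp_t *
      (five_ddt_plus 1 \<circ> five_ddt_plus 2 \<circ> five_ddt_plus 3 \<circ> five_ddt_plus 4) J) $ n
      = (fps_const (15 / 8) * (exp_half :: 'a fps)) $ n"
    by (simp only: L_def fps_sub_nth fps_nth_numeral_mult mult.assoc)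
qed

end
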